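(* Let $n\ge 1$ and let $R\cong(\mathbb{F}_2)^n$. The subgraph of $\Gamma'_{Reg}(R)$ induced by $R\setminus\{0_R,1_R\}$ is isomorphic to the graph $In(R)$.
   Context: For a commutative von Neumann regular ring $R$ with identity (i.e. for every $x\in R$ there is $y\in R$ with $xyx=x$), $\Gamma'_{Reg}(R)$ is the simple graph with vertex set $R\setminus\{0_R\}$ in which two distinct vertices $a,b$ are adjacent if and only if $aba=a$ or $bab=b$. The inclusion ideal graph $In(R)$ has as vertices all nontrivial ideals of $R$ (ideals different from $\{0_R\}$ and $R$), two distinct vertices $I,J$ being adjacent if and only if $I\subset J$ or $J\subset I$. $\mathbb{F}_2$ is the field with two elements. *)

theory Defs
  imports
    "HOL-Algebra.Chinese_Remainder"
    "HOL-Number_Theory.Residues"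
    "Graph_Theory.Digraph_Isomorphism"
    "Graph_Theory.Pair_Digraph"
begin

locale comm_von_neumann_regular_ring = cring R for R (structure) +
  assumes regular: "x \<in> carrier R \<Longrightarrow> \<exists>y\<in>carrier R. x \<otimes> y \<otimes> x = x"

text \<open>
  A simple graph is an irreflexive symmetric digraph without parallel arcs: every
  edge is represented by its two orientations. The null graph is allowed: a field has no
  nontrivial ideals.
\<close>

definition regular_graph :: "('a, 'm) ring_scheme \<Rightarrow> 'a pair_pre_digraph" where
  "regular_graph R =
    \<lparr>pverts = carrier R - {\<zero>\<^bsub>R\<^esub>},
     parcs = {(a, b). a \<in> carrier R - {\<zero>\<^bsub>R\<^esub>} \<and> b \<in> carrier R - {\<zero>\<^bsub>R\<^esub>} \<and> a \<noteq> b \<and>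
       (a \<otimes>\<^bsub>R\<^esub> b \<otimes>\<^bsub>R\<^esub> a = a \<or> b \<otimes>\<^bsub>R\<^esub> a \<otimes>\<^bsub>R\<^esub> b = b)}\<rparr>"

definition nontrivial_ideals :: "('a, 'm) ring_scheme \<Rightarrow> 'a set set" where
  "nontrivial_ideals R = {I. ideal I R \<and> I \<noteq> {\<zero>\<^bsub>R\<^esub>} \<and> I \<noteq> carrier R}"

definition inclusion_ideal_graph :: "('a, 'm) ring_scheme \<Rightarrow> 'a set pair_pre_digraph" where
  "inclusion_ideal_graph R =
    \<lparr>pverts = nontrivial_ideals R,
     parcs = {(I, J). I \<in> nontrivial_ideals R \<and> J \<in> nontrivial_ideals R \<and> (I \<subset> J \<or> J \<subset> I)}\<rparr>"

lemma regular_graph_simple: "pair_bidirected_digraph (regular_graph R)"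
  by unfold_locales (auto simp: regular_graph_def symmetric_def sym_def)

lemma inclusion_ideal_graph_simple: "pair_bidirected_digraph (inclusion_ideal_graph R)"
  by unfold_locales (auto simp: inclusion_ideal_graph_def symmetric_def sym_def)

text \<open>On graphs given by pairs, the library's isomorphism notion is the usual one: an
  adjacency-preserving and -reflecting bijection of the vertices.\<close>

lemma digraph_iso_with_proj_iff:
  assumes "pair_wf_digraph G" and "pair_wf_digraph H"
  shows "digraph_iso (with_proj G) (with_proj H) \<longleftrightarrow>
    (\<exists>f. bij_betw f (pverts G) (pverts H) \<and>
      (\<forall>u\<in>pverts G. \<forall>v\<in>pverts G. (u, v) \<in> parcs G \<longleftrightarrow> (f u, f v) \<in> parcs H))"
    (is "_ \<longleftrightarrow> (\<exists>f. ?iso f)")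
proof
  interpret G: pair_wf_digraph G by fact
  assume "digraph_iso (with_proj G) (with_proj H)"
  then obtain k where k: "pre_digraph.digraph_isomorphism (with_proj G) k"
    and H: "with_proj H = app_iso k (with_proj G)"
    by (auto simp: digraph_iso_def)
  have eqs: "pverts H = iso_verts k ` pverts G" "parcs H = iso_arcs k ` parcs G"
    "iso_tail k = fst" "iso_head k = snd"
    using H by (auto simp: with_proj_def app_iso_def)
  have inj: "inj_on (iso_verts k) (pverts G)"
    using k by (simp add: pre_digraph.digraph_isomorphism_def)
  have arcs: "iso_arcs k e = (iso_verts k (fst e), iso_verts k (snd e))" if "e \<in> parcs G" for e
    using k that eqs(3,4) by (auto simp: pre_digraph.digraph_isomorphism_def prod_eq_iff)
  have "parcs H = (\<lambda>e. (iso_verts k (fst e), iso_verts k (snd e))) ` parcs G"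
    unfolding eqs(2) using arcs by (intro image_cong) auto
  then have *: "(a, b) \<in> parcs H \<longleftrightarrow>
      (\<exists>u v. (u, v) \<in> parcs G \<and> a = iso_verts k u \<and> b = iso_verts k v)" for a b
    by force
  have "(u, v) \<in> parcs G \<longleftrightarrow> (iso_verts k u, iso_verts k v) \<in> parcs H"
    if "u \<in> pverts G" "v \<in> pverts G" for u v
    unfolding * using that inj G.wellformed' by (metis inj_onD)
  then have "?iso (iso_verts k)"
    using inj eqs(1) by (simp add: bij_betw_def)
  then show "\<exists>f. ?iso f"
    by (intro exI[of _ "iso_verts k"])
next
  interpret G: pair_wf_digraph G by fact
  interpret H: pair_wf_digraph H by fact
  assume "\<exists>f. ?iso f"
  then obtain f where f: "?iso f" ..
  define k where "k = \<lparr>iso_verts = f, iso_arcs = map_prod f f, iso_head = snd, iso_tail = fst\<rparr>"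
  have inj: "inj_on f (pverts G)" and im: "f ` pverts G = pverts H"
    using f by (auto simp: bij_betw_def)
  have "inj_on (map_prod f f) (parcs G)"
    using map_prod_inj_on[OF inj inj] by (rule inj_on_subset) (auto dest: G.wellformed')
  then have "pre_digraph.digraph_isomorphism (with_proj G) k"
    using inj G.wf_digraph by (simp add: pre_digraph.digraph_isomorphism_def k_def)
  moreover have "parcs H = map_prod f f ` parcs G"
  proof (intro equalityI subsetI)
    fix e assume e: "e \<in> parcs H"
    then obtain u v where "e = (f u, f v)" "u \<in> pverts G" "v \<in> pverts G"
      using im H.wellformed' by (metis imageE prod.collapse)
    then show "e \<in> map_prod f f ` parcs G"
      using f e by (intro image_eqI[of _ _ "(u, v)"]) auto
  next
    fix e assume "e \<in> map_prod f f ` parcs G"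
    then show "e \<in> parcs H"
      using f by (auto dest: G.wellformed')
  qed
  then have "with_proj H = app_iso k (with_proj G)"
    using im by (simp add: with_proj_def app_iso_def k_def)
  ultimately show "digraph_iso (with_proj G) (with_proj H)"
    by (auto simp: digraph_iso_def)
qed

abbreviation F2 :: "int ring" where
  "F2 \<equiv> residue_ring 2"

text \<open>The carrier of the library's list product consists of the lists of length \<open>n\<close>
  over the carrier of \<open>F2\<close>, with componentwise operations.\<close>

definition F2_power :: "nat \<Rightarrow> int list ring" where
  "F2_power n = RDirProd_list (replicate n F2)"

lemma F2_power_0: "F2_power 0 = nil_ring"
  by (simp add: F2_power_def)

lemma F2_power_Suc_iso:
  "(\<lambda>(a, as). a # as) \<in> ring_iso (RDirProd F2 (F2_power n)) (F2_power (Suc n))"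
  unfolding F2_power_def using RDirProd_list_iso1[of F2 "replicate n F2"] by simp

lemma carrier_F2_power:
  "carrier (F2_power n) = {xs. length xs = n \<and> set xs \<subseteq> {0, 1}}"
proof -
  have F2: "carrier F2 = {0, 1}"
    by (auto simp: residue_ring_def)
  have "xs \<in> carrier (F2_power n) \<longleftrightarrow> length xs = n \<and> (\<forall>i<n. xs ! i \<in> {0, 1})" for xs
    unfolding F2_power_def
    using RDirProd_list_carrier_mem[of xs "replicate n F2"]
      RDirProd_list_carrier_memI[of xs "replicate n F2"] F2
    by (metis length_replicate nth_replicate)
  then show ?thesis
    by (auto simp: in_set_conv_nth subset_iff)
qed

lemma mult_F2_power:
  assumes "xs \<in> carrier (F2_power n)" and "ys \<in> carrier (F2_power n)"
  shows "xs \<otimes>\<^bsub>F2_power n\<^esub> ys = map2 (\<lambda>x y. x * y mod 2) xs ys"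
  using assms
proof (induction n arbitrary: xs ys)
  case 0
  then show ?case
    by (simp add: F2_power_0 monoid.defs)
next
  case (Suc n)
  let ?c = "\<lambda>(a, as). a # as :: int list"
  have carr: "carrier (F2_power (Suc n)) = ?c ` (carrier F2 \<times> carrier (F2_power n))"
    unfolding F2_power_def using RDirProd_list_carrier[of F2 "replicate n F2"] by simp
  obtain x xs' y ys' where xy: "xs = x # xs'" "ys = y # ys'"
    "x \<in> carrier F2" "y \<in> carrier F2" "xs' \<in> carrier (F2_power n)" "ys' \<in> carrier (F2_power n)"
    using Suc.prems unfolding carr by auto
  have "?c ((x, xs') \<otimes>\<^bsub>RDirProd F2 (F2_power n)\<^esub> (y, ys')) =
      ?c (x, xs') \<otimes>\<^bsub>F2_power (Suc n)\<^esub> ?c (y, ys')"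
    using F2_power_Suc_iso[of n] xy
    by (intro ring_hom_mult[where R = "RDirProd F2 (F2_power n)"])
       (auto simp: ring_iso_def RDirProd_carrier)
  moreover have "(x, xs') \<otimes>\<^bsub>RDirProd F2 (F2_power n)\<^esub> (y, ys') =
      (x \<otimes>\<^bsub>F2\<^esub> y, xs' \<otimes>\<^bsub>F2_power n\<^esub> ys')"
    by (simp add: RDirProd_def DirProd_def monoid.defs)
  ultimately show ?case
    using Suc.IH[OF xy(5,6)] xy(1,2) by (simp add: residue_ring_def)
qed

lemma add_F2_power:
  assumes "xs \<in> carrier (F2_power n)" and "ys \<in> carrier (F2_power n)"
  shows "xs \<oplus>\<^bsub>F2_power n\<^esub> ys = map2 (\<lambda>x y. (x + y) mod 2) xs ys"
  using assms
proof (induction n arbitrary: xs ys)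
  case 0
  then show ?case
    by (simp add: F2_power_0 monoid.defs)
next
  case (Suc n)
  let ?c = "\<lambda>(a, as). a # as :: int list"
  have carr: "carrier (F2_power (Suc n)) = ?c ` (carrier F2 \<times> carrier (F2_power n))"
    unfolding F2_power_def using RDirProd_list_carrier[of F2 "replicate n F2"] by simp
  obtain x xs' y ys' where xy: "xs = x # xs'" "ys = y # ys'"
    "x \<in> carrier F2" "y \<in> carrier F2" "xs' \<in> carrier (F2_power n)" "ys' \<in> carrier (F2_power n)"
    using Suc.prems unfolding carr by auto
  have "?c ((x, xs') \<oplus>\<^bsub>RDirProd F2 (F2_power n)\<^esub> (y, ys')) =
      ?c (x, xs') \<oplus>\<^bsub>F2_power (Suc n)\<^esub> ?c (y, ys')"
    using F2_power_Suc_iso[of n] xy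
    by (intro ring_hom_add[where R = "RDirProd F2 (F2_power n)"])
       (auto simp: ring_iso_def RDirProd_carrier)
  moreover have "(x, xs') \<oplus>\<^bsub>RDirProd F2 (F2_power n)\<^esub> (y, ys') =
      (x \<oplus>\<^bsub>F2\<^esub> y, xs' \<oplus>\<^bsub>F2_power n\<^esub> ys')"
    by (simp add: RDirProd_def DirProd_def monoid.defs)
  ultimately show ?case
    using Suc.IH[OF xy(5,6)] xy(1,2) by (simp add: residue_ring_def)
qed

text \<open>The regular graph is considered for commutative von Neumann regular rings
  only; rings isomorphic to a power of \<open>F2\<close> are of this kind.\<close>

lemma F2_power_iso_regular:
  assumes "cring R" and "R \<simeq> F2_power n"
  shows "comm_von_neumann_regular_ring R"
proof -
  interpret cring R by fact
  obtain h where h: "h \<in> ring_hom R (F2_power n)" "bij_betw h (carrier R) (carrier (F2_power n))"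
    using assms(2) by (auto simp: is_ring_iso_def ring_iso_def)
  have "x \<otimes>\<^bsub>R\<^esub> x = x" if x: "x \<in> carrier R" for x
  proof -
    have hx: "h x \<in> carrier (F2_power n)"
      using h(1) x by (rule ring_hom_closed)
    have "map2 (\<lambda>x y. x * y mod 2) xs xs = xs" if "set xs \<subseteq> {0, 1}" for xs :: "int list"
      using that by (induction xs) auto
    then have "h (x \<otimes>\<^bsub>R\<^esub> x) = h x"
      using hx ring_hom_mult[OF h(1) x x] by (simp add: mult_F2_power carrier_F2_power)
    then show ?thesis
      using h(2) x by (auto simp: bij_betw_def dest: inj_onD)
  qed
  then show ?thesis
    by unfold_locales force
qed

lemma field_F2: "field F2"
proof -
  interpret residues_prime 2 F2
    by unfold_locales auto
  show ?thesis by (rule is_field)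
qed

end

theory Submission
  imports Defs
begin

text \<open>
  A ring isomorphic to a power of \<open>\<bbbF>\<^sub>2\<close> is finite and every element is idempotent. In such a ring
  \<open>aba = a\<close> means \<open>ab = a\<close>, that is, \<open>(a) \<subseteq> (b)\<close>, and every ideal is generated by a
  unique element. Hence \<open>a \<mapsto> (a)\<close> is the isomorphism; it sends \<open>0\<close> and \<open>1\<close> to the two
  trivial ideals.
\<close>

locale boolean_ring = cring R for R (structure) +
  assumes idem [simp]: "x \<in> carrier R \<Longrightarrow> x \<otimes> x = x"
begin

lemma mult_idem_left: "a \<in> carrier R \<Longrightarrow> b \<in> carrier R \<Longrightarrow> a \<otimes> b \<otimes> a = a \<otimes> b"
  by (metis idem m_assoc m_comm)

text \<open>If \<open>a = r \<otimes> b\<close>, idempotence of \<open>b\<close> gives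
  \<open>a \<otimes> b = r \<otimes> b \<otimes> b = a\<close>. Conversely,
  \<open>a = a \<otimes> b\<close> itself exhibits \<open>a\<close> as a multiple of
  \<open>b\<close>.\<close>

lemma cgenideal_subset_iff:
  assumes a: "a \<in> carrier R" and b: "b \<in> carrier R"
  shows "PIdl a \<subseteq> PIdl b \<longleftrightarrow> a \<otimes> b = a"
proof
  assume "PIdl a \<subseteq> PIdl b"
  then obtain r where r: "r \<in> carrier R" "a = r \<otimes> b"
    using cgenideal_self[OF a] by (auto simp: cgenideal_def)
  then show "a \<otimes> b = a"
    using b by (simp add: m_assoc)
next
  assume "a \<otimes> b = a"
  then have "a \<in> PIdl b"
    using a by (auto simp: cgenideal_def intro!: exI[of _ a])
  then show "PIdl a \<subseteq> PIdl b"
    by (rule cgenideal_minimal[OF cgenideal_ideal[OF b]])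
qed

text \<open>The two inclusions yield \<open>a = a \<otimes> b = b \<otimes> a = b\<close>.\<close>

lemma inj_on_cgenideal: "inj_on (cgenideal R) (carrier R)"
proof (rule inj_onI)
  fix a b assume "a \<in> carrier R" "b \<in> carrier R" "PIdl a = PIdl b"
  then show "a = b"
    by (metis cgenideal_subset_iff m_comm order_refl)
qed

text \<open>Induction on \<open>F\<close> with \<open>I\<close> fixed: a unit for \<open>F\<close>
  inside \<open>I\<close> is enlarged to one that also fixes the new element. Taking
  \<open>F = I\<close> later yields a generator of a finite ideal.\<close>

lemma finite_subset_ideal_unit:
  assumes I: "ideal I R" and F: "finite F" "F \<subseteq> I"
  shows "\<exists>e\<in>I. \<forall>x\<in>F. x \<otimes> e = x"
  using F
proof (induction F rule: finite_induct)
  case empty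
  interpret ideal I R by fact
  show ?case
    using zero_closed by blast
next
  case (insert y F)
  interpret ideal I R by fact
  obtain e where e: "e \<in> I" "\<forall>x\<in>F. x \<otimes> e = x"
    using insert by auto
  have carr: "e \<in> carrier R" "y \<in> carrier R" "\<And>x. x \<in> F \<Longrightarrow> x \<in> carrier R"
    using e insert.prems Icarr by auto
  \<comment> \<open>The new unit is the join of \<open>e\<close> and \<open>y\<close> in the Boolean
    algebra of idempotents; it absorbs whatever \<open>e\<close> or \<open>y\<close>
    absorbs.\<close>
  have mem: "e \<oplus> y \<ominus> e \<otimes> y \<in> I"
    using e insert.prems carr by (auto simp: minus_eq intro!: a_closed a_inv_closed I_r_closed)
  have "x \<otimes> (e \<oplus> y \<ominus> e \<otimes> y) = x" if "x \<in> F" for x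
  proof -
    have "x \<otimes> (e \<oplus> y \<ominus> e \<otimes> y) = x \<otimes> e \<oplus> x \<otimes> y \<ominus> x \<otimes> e \<otimes> y"
      using carr that by algebra
    also have "\<dots> = x"
      using carr that e(2) by (simp add: minus_eq a_assoc r_neg)
    finally show ?thesis .
  qed
  moreover have "y \<otimes> (e \<oplus> y \<ominus> e \<otimes> y) = e \<otimes> y \<oplus> y \<otimes> y \<ominus> e \<otimes> (y \<otimes> y)"
    using carr by algebra
  then have "y \<otimes> (e \<oplus> y \<ominus> e \<otimes> y) = y"
    using carr by simp algebra
  ultimately show ?case
    using mem by auto
qed

text \<open>A unit \<open>e\<close> of the whole of \<open>I\<close> generates it: each
  \<open>x\<close> in \<open>I\<close> equals \<open>x \<otimes> e\<close>, and \<open>e\<close>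
  lies in \<open>I\<close>.\<close>

lemma finite_ideal_principal:
  assumes I: "ideal I R" and fin: "finite I"
  obtains e where "e \<in> carrier R" "I = PIdl e"
proof -
  interpret ideal I R by fact
  obtain e where e: "e \<in> I" "\<forall>x\<in>I. x \<otimes> e = x"
    using finite_subset_ideal_unit[OF I fin] by auto
  have "I \<subseteq> PIdl e"
  proof
    fix x assume "x \<in> I"
    then show "x \<in> PIdl e"
      using e(2) Icarr[of x] by (auto simp: cgenideal_def intro!: exI[of _ x])
  qed
  then have "I = PIdl e"
    using cgenideal_minimal[OF I e(1)] by auto
  then show ?thesis
    using that e(1) Icarr by blast
qed

lemma bij_betw_cgenideal:
  assumes fin: "finite (carrier R)"
  shows "bij_betw (cgenideal R) (carrier R - {\<zero>, \<one>}) (nontrivial_ideals R)"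
proof -
  have ideals: "cgenideal R ` carrier R = {I. ideal I R}"
  proof (intro equalityI subsetI)
    fix I assume "I \<in> {I. ideal I R}"
    then have I: "ideal I R" ..
    then interpret ideal I R .
    have "finite I"
      using fin a_subset finite_subset by blast
    then obtain e where "e \<in> carrier R" "I = PIdl e"
      using finite_ideal_principal[OF I] by blast
    then show "I \<in> cgenideal R ` carrier R"
      by blast
  qed (auto intro: cgenideal_ideal)
  have zero: "PIdl \<zero> = {\<zero>}"
    by (force simp: cgenideal_def)
  have one: "PIdl \<one> = carrier R"
    by (force simp: cgenideal_def)
  \<comment> \<open>By injectivity, removing zero and one before taking images removes exactly the
    ideals that they generate.\<close>
  have "cgenideal R ` (carrier R - {\<zero>, \<one>}) = {I. ideal I R} - {{\<zero>}, carrier R}"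
    using inj_on_image_set_diff[OF inj_on_cgenideal, of "carrier R" "{\<zero>, \<one>}"]
    by (simp add: ideals zero one)
  also have "\<dots> = nontrivial_ideals R"
    by (auto simp: nontrivial_ideals_def)
  finally show ?thesis
    using inj_on_subset[OF inj_on_cgenideal] by (auto simp: bij_betw_def)
qed

text \<open>This matches one disjunct of adjacency in the regular graph with one direction of strict
  inclusion; strictness becomes \<open>a \<noteq> b\<close> by injectivity.\<close>

lemma cgenideal_psubset_iff:
  assumes "a \<in> carrier R" "b \<in> carrier R"
  shows "PIdl a \<subset> PIdl b \<longleftrightarrow> a \<noteq> b \<and> a \<otimes> b \<otimes> a = a"
  using assms inj_on_eq_iff[OF inj_on_cgenideal]
  by (simp add: psubset_eq cgenideal_subset_iff mult_idem_left conj_commute)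

end

text \<open>Both properties hold for 0-1 lists of length \<open>n\<close> and are pulled back along
  the bijective homomorphism \<open>h\<close>.\<close>

lemma F2_power_iso_boolean:
  assumes "cring R" and "R \<simeq> F2_power n"
  shows "boolean_ring R" and "finite (carrier R)"
proof -
  interpret cring R by fact
  obtain h where h: "h \<in> ring_hom R (F2_power n)" "bij_betw h (carrier R) (carrier (F2_power n))"
    using assms(2) by (auto simp: is_ring_iso_def ring_iso_def)
  show "boolean_ring R"
  proof
    fix x assume x: "x \<in> carrier R"
    have hx: "h x \<in> carrier (F2_power n)"
      using h(1) x by (rule ring_hom_closed)
    have "map2 (\<lambda>x y. x * y mod 2) xs xs = xs" if "set xs \<subseteq> {0, 1}" for xs :: "int list"
      using that by (induction xs) auto
    then have "h (x \<otimes>\<^bsub>R\<^esub> x) = h x"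
      using hx ring_hom_mult[OF h(1) x x] by (simp add: mult_F2_power carrier_F2_power)
    then show "x \<otimes>\<^bsub>R\<^esub> x = x"
      using h(2) x by (auto simp: bij_betw_def dest: inj_onD)
  qed
  have "finite (carrier (F2_power n))"
    using finite_lists_length_eq[of "{0, 1 :: int}" n]
    by (simp add: carrier_F2_power conj_commute)
  then show "finite (carrier R)"
    using bij_betw_finite[OF h(2)] by simp
qed

theorem theorem13:
  fixes R :: "('a, 'm) ring_scheme" and n :: nat
  assumes "n \<ge> 1" and "cring R" and "R \<simeq> F2_power n"
  shows "digraph_iso
    (induce_subgraph (with_proj (regular_graph R)) (carrier R - {\<zero>\<^bsub>R\<^esub>, \<one>\<^bsub>R\<^esub>}))
    (with_proj (inclusion_ideal_graph R))"
proof -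
  interpret boolean_ring R
    by (rule F2_power_iso_boolean(1)[OF assms(2,3)])
  let ?V = "carrier R - {\<zero>\<^bsub>R\<^esub>, \<one>\<^bsub>R\<^esub>}"
  \<comment> \<open>The induced subgraph is restated as a pair digraph, the form that
    \<open>digraph_iso_with_proj_iff\<close> requires.\<close>
  define G where "G = \<lparr>pverts = ?V, parcs = {(a, b) \<in> parcs (regular_graph R). a \<in> ?V \<and> b \<in> ?V}\<rparr>"
  interpret H: pair_bidirected_digraph "inclusion_ideal_graph R"
    by (rule inclusion_ideal_graph_simple)
  have induced: "induce_subgraph (with_proj (regular_graph R)) ?V = with_proj G"
    by (auto simp: G_def with_proj_def induce_subgraph_def)
  have wf: "pair_wf_digraph G"
    by unfold_locales (auto simp: G_def)
  have bij: "bij_betw (cgenideal R) ?V (nontrivial_ideals R)"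
    by (rule bij_betw_cgenideal[OF F2_power_iso_boolean(2)[OF assms(2,3)]])
  have adj: "(a, b) \<in> parcs G \<longleftrightarrow> (PIdl\<^bsub>R\<^esub> a, PIdl\<^bsub>R\<^esub> b) \<in> parcs (inclusion_ideal_graph R)"
    if "a \<in> ?V" "b \<in> ?V" for a b
    using that bij_betwE[OF bij]
    by (auto simp: G_def regular_graph_def inclusion_ideal_graph_def cgenideal_psubset_iff)
  show ?thesis
    unfolding induced digraph_iso_with_proj_iff[OF wf H.pair_wf_digraph_axioms]
    using bij adj by (intro exI[of _ "cgenideal R"]) (simp add: G_def inclusion_ideal_graph_def)
qed

end
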